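(* Let $n\geq 4$ and write $n=\sum_{i=0}^m 2^ib_i$ with $b_i\in\{0,1\}$ and $b_m=1$ (the binary expansion of $n$). For $1\le i\le m-1$ let $M_i=\begin{bmatrix}1 & 1-b_i\\ b_i & 1 \end{bmatrix}$. Then $$t(n)=(-1)^m\begin{bmatrix}1 & -1\end{bmatrix} M_{m-1}M_{m-2}\cdots M_1\begin{bmatrix}1\\ b_0 \end{bmatrix}.$$
   Context: The twisted Stern sequence is defined by $t(0)=0$, $t(1)=1$, and for $n\ge1$, $t(2n)=-t(n)$, $t(2n+1)=-t(n)-t(n+1)$. *)

theory Defs
  imports "HOL-Analysis.Analysis"
begin

function twisted_stern :: "nat \<Rightarrow> int" where
  "twisted_stern 0 = 0"
| "twisted_stern (Suc 0) = 1"
| "n > 0 \<Longrightarrow> twisted_stern (2 * n) = - twisted_stern n"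
| "n > 0 \<Longrightarrow> twisted_stern (2 * n + 1) = - twisted_stern n - twisted_stern (n + 1)"
proof -
  fix P :: bool and x :: nat
  assume "x = 0 \<Longrightarrow> P" "x = Suc 0 \<Longrightarrow> P"
    and "\<And>n. n > 0 \<Longrightarrow> x = 2 * n \<Longrightarrow> P"
    and "\<And>n. n > 0 \<Longrightarrow> x = 2 * n + 1 \<Longrightarrow> P"
  moreover have "x = 2 * (x div 2) \<or> x = 2 * (x div 2) + 1"
    by linarith
  moreover have "x = 0 \<or> x = Suc 0 \<or> x div 2 > 0"
    by linarith
  ultimately show P
    by blast
next
  fix n :: nat
  assume "Suc 0 = 2 * n"
  then have False
    by presburger
  then show "1 = - twisted_stern_sumC n" ..
next
  fix n k :: nat
  assume "2 * n = 2 * k + 1"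
  then have False
    by presburger
  then show "- twisted_stern_sumC n = - twisted_stern_sumC k - twisted_stern_sumC (k + 1)" ..
qed simp_all
termination by (relation "Wellfounded.measure (\<lambda>n. n)") simp_all

definition stern_matrix :: "int \<Rightarrow> int^2^2" where
  "stern_matrix c = vector [vector [1, 1 - c], vector [c, 1]]"

text \<open>The product of a list of square matrices, taken in the order of the list.\<close>

definition matrix_prod_list :: "(int^2^2) list \<Rightarrow> int^2^2" where
  "matrix_prod_list As = foldr (**) As (mat 1)"

end

theory Submission
  imports Defs
begin

text \<open>Write \<open>N k\<close> for the number whose binary digits are \<open>b k, \<dots>, b m\<close>. Reading the digits from the
  most significant one downwards, the row vector \<open>[1, -1] M\<^sub>m\<^sub>-\<^sub>1 \<cdots> M\<^sub>k\<close> equals, up to the sign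
  \<open>(-1)\<^sup>m\<^sup>-\<^sup>k\<close>, the pair of consecutive values \<open>[t (N k), t (N k + 1)]\<close>: multiplication by \<open>M\<^sub>k\<close> is the
  passage from \<open>(N, N + 1)\<close> to \<open>(2 N + c, 2 N + c + 1)\<close> with \<open>c = b k\<close>, without the sign. The last
  digit only needs the first entry of that passage, hence the column \<open>[1, b 0]\<close>.\<close>

lemma twisted_stern_append_bit:
  fixes N c :: nat
  assumes "N > 0" and "c \<in> {0, 1}"
  shows "twisted_stern (2 * N + c) = - (twisted_stern N + int c * twisted_stern (N + 1))"
    and "twisted_stern (2 * N + c + 1) = - ((1 - int c) * twisted_stern N + twisted_stern (N + 1))"
proof -
  \<comment> \<open>For \<open>c = 1\<close> the second entry sits at the even number
    \<open>2 * N + 2\<close>, twice \<open>N + 1\<close>.\<close>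
  have "twisted_stern (2 * N + 2) = - twisted_stern (N + 1)"
    using twisted_stern.simps(3)[of "N + 1"] by simp
  then show "twisted_stern (2 * N + c) = - (twisted_stern N + int c * twisted_stern (N + 1))"
    and "twisted_stern (2 * N + c + 1) = - ((1 - int c) * twisted_stern N + twisted_stern (N + 1))"
    using assms twisted_stern.simps(3,4)[of N] by auto
qed

lemma row_mult_stern_matrix:
  fixes v :: "int^2^1"
  shows "(v ** stern_matrix c) $ 1 $ 1 = v $ 1 $ 1 + c * v $ 1 $ 2"
    and "(v ** stern_matrix c) $ 1 $ 2 = (1 - c) * v $ 1 $ 1 + v $ 1 $ 2"
  by (simp_all add: matrix_matrix_mult_def stern_matrix_def sum_2 algebra_simps)

text \<open>Lowering \<open>k\<close> by one appends a factor at the right end of the list over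
  \<open>rev [k..<m]\<close>, while \<open>foldr\<close> peels from the left.\<close>

lemma matrix_prod_list_snoc:
  "matrix_prod_list (As @ [A]) = matrix_prod_list As ** A"
  by (induction As) (simp_all add: matrix_prod_list_def matrix_mul_assoc)

definition top_bits :: "(nat \<Rightarrow> nat) \<Rightarrow> nat \<Rightarrow> nat \<Rightarrow> nat" where
  "top_bits b m k = (\<Sum>i=k..m. 2 ^ (i - k) * b i)"

lemma top_bits_self [simp]: "top_bits b m m = b m"
  by (simp add: top_bits_def)

lemma top_bits_less:
  assumes "k < m"
  shows "top_bits b m k = 2 * top_bits b m (Suc k) + b k"
proof -
  have "top_bits b m k = b k + (\<Sum>i=Suc k..m. 2 ^ (i - k) * b i)"
    using assms by (simp add: top_bits_def sum.atLeast_Suc_atMost)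
  also have "(\<Sum>i=Suc k..m. 2 ^ (i - k) * b i) = (\<Sum>i=Suc k..m. 2 * (2 ^ (i - Suc k) * b i))"
    by (intro sum.cong) (auto simp: Suc_diff_le[symmetric] simp flip: power_Suc mult.assoc)
  finally show ?thesis
    by (simp add: top_bits_def sum_distrib_left)
qed

text \<open>Needed because the recurrences fail at 0: \<open>twisted_stern 1\<close> is 1, not
  -1.\<close>

lemma top_bits_pos:
  assumes "k \<le> m" and "b m > 0"
  shows "top_bits b m k > 0"
  using assms by (induction rule: inc_induct) (simp_all add: top_bits_less)

lemma row_matrix_prod_list:
  fixes b :: "nat \<Rightarrow> nat"
  defines "R \<equiv> \<lambda>m k. (vector [vector [1, -1]] :: int^2^1)
    ** matrix_prod_list (map (\<lambda>i. stern_matrix (int (b i))) (rev [k..<m]))"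
  assumes "k \<le> m" and bits: "\<forall>i\<le>m. b i \<in> {0, 1}" and top: "b m = 1"
  shows "R m k $ 1 $ 1 = (-1) ^ (m - k) * twisted_stern (top_bits b m k) \<and>
    R m k $ 1 $ 2 = (-1) ^ (m - k) * twisted_stern (top_bits b m k + 1)"
  using \<open>k \<le> m\<close>
proof (induction rule: inc_induct)
  case base
  \<comment> \<open>The empty product leaves \<open>[1, -1]\<close>, which is the pair of values at
    1 and 2.\<close>
  have "twisted_stern 2 = - 1"
    using twisted_stern.simps(3)[of 1] by simp
  then show ?case
    by (simp add: R_def matrix_prod_list_def top numeral_2_eq_2)
next
  case (step k)
  have R: "R m k = R m (Suc k) ** stern_matrix (int (b k))"
    using step.hyps by (simp add: R_def upt_conv_Cons matrix_prod_list_snoc matrix_mul_assoc)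
  have sign: "(-1 :: int) ^ (m - k) = - ((-1) ^ (m - Suc k))"
    using step.hyps by (simp add: Suc_diff_Suc[symmetric])
  have "top_bits b m (Suc k) > 0"
    using step.hyps top by (intro top_bits_pos) simp_all
  then show ?case
    using step.IH step.hyps bits[rule_format, of k]
    by (simp only: R sign row_mult_stern_matrix top_bits_less twisted_stern_append_bit)
      (simp add: algebra_simps)
qed

theorem theorem4p2:
  fixes n m :: nat and b :: "nat \<Rightarrow> nat"
  assumes "n \<ge> 4"
    and "n = (\<Sum>i=0..m. 2 ^ i * b i)"
    and "\<And>i. i \<le> m \<Longrightarrow> b i \<in> {0, 1}"
    and "b m = 1"
  shows "twisted_stern n =
    (-1) ^ m *
    ((vector [vector [1, -1]] :: int^2^1)
      ** matrix_prod_list (map (\<lambda>i. stern_matrix (int (b i))) (rev [1..<m]))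
      ** (vector [vector [1], vector [int (b 0)]] :: int^1^2)) $ 1 $ 1"
proof -
  have "m > 0"
    \<comment> \<open>If \<open>m = 0\<close>, then \<open>n = b 0 = 1 < 4\<close>.\<close>
    using assms(1,2,4) by (cases m) simp_all
  then have n: "n = 2 * top_bits b m 1 + b 0"
    using assms(2) top_bits_less[of 0 m b] by (simp add: top_bits_def)
  have sign: "(-1 :: int) ^ m = - ((-1) ^ (m - 1))"
    using \<open>m > 0\<close> by (cases m) simp_all
  have col: "(v ** (vector [vector [1], vector [c]] :: int^1^2)) $ 1 $ 1 = v $ 1 $ 1 + c * v $ 1 $ 2"
    for v :: "int^2^1" and c
    by (simp add: matrix_matrix_mult_def sum_2)
  have "top_bits b m 1 > 0"
    using \<open>m > 0\<close> assms(4) by (intro top_bits_pos) simp_all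
  then have t: "twisted_stern n =
      - (twisted_stern (top_bits b m 1) + int (b 0) * twisted_stern (top_bits b m 1 + 1))"
    unfolding n using assms(3)[of 0] by (intro twisted_stern_append_bit) simp_all
  \<comment> \<open>Both row entries carry the sign \<open>s = (-1) ^ (m - 1)\<close>; the prefactor
    supplies a second \<open>s\<close>, and the last digit accounts for the remaining minus.\<close>
  have cancel: "x + c * y = s * (s * x + c * (s * y))" if "s * s = 1" for s x y c :: int
    using that by algebra
  have "1 \<le> m" and "\<forall>i\<le>m. b i \<in> {0, 1}"
    using \<open>m > 0\<close> assms(3) by auto
  note row = row_matrix_prod_list[OF this assms(4)]
  show ?thesis
    unfolding t col row[THEN conjunct1] row[THEN conjunct2] sign mult_minus_left
    by (subst cancel[of "(-1) ^ (m - 1)"]) (simp_all flip: power_mult_distrib)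
qed

end
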